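(* Let $G=(V,E)$ be a $d$-regular directed graph with $|V(G)|=2n$, let $\pi=\{C_1,\dots,C_n\}$ be an equitable partition of $V(G)$, and let $G/\pi$ be the quotient digraph, which is assumed to be $d$-regular. Then there exist equitable partitions $\tau$ of the vertex set of the line digraph $LD(G)$ and $\sigma$ of the vertex set of the line digraph $LD(G/\pi)$, obtained by grouping arcs (of $G$, respectively of $G/\pi$) according to their terminal vertices, such that $$LD(G)/\tau\;\cong\;G\qquad\text{and}\qquad LD(G/\pi)/\sigma\;\cong\;G/\pi .$$
   Context: A directed graph is $d$-regular if every vertex has in-degree $d$ and out-degree $d$ (counting multiplicity and loops). The line digraph $LD(G)$ has as vertices the arcs of $G$, with an arc from $a$ to $b$ iff the terminal vertex of $a$ is the initial vertex of $b$. A partition $\{C_1,\dots,C_r\}$ of the vertex set of a directed graph is equitable if for all $i,j$ every vertex of $C_i$ has the same number $b_{ij}$ of out-neighbours in $C_j$ (with multiplicity). The quotient graph is the directed multigraph (loops allowed) whose vertices are the cells and whose adjacency matrix is $\widetilde A=(b_{ij})$. A partition of the vertex set of $LD(G)$ is also called an arc partition.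
   Formalization: The degree d is assumed to be at least 1; for d = 0 and n ≥ 1 the claim fails, since G then has no arcs, LD(G) is empty, and no quotient of it can be isomorphic to G with its 2n vertices. *)

theory Defs
  imports "Graph_Theory.Digraph_Isomorphism" "HOL-Library.Disjoint_Sets"
begin

text \<open>
  Directed graphs are finite directed multigraphs (\<^locale>\<open>fin_digraph\<close>): parallel arcs and
  loops are allowed, and every arc counts separately in degrees and numbers of out-neighbours.
\<close>

definition regular_digraph :: "('a, 'b) pre_digraph \<Rightarrow> nat \<Rightarrow> bool" where
  "regular_digraph G d \<longleftrightarrow>
     fin_digraph G \<and> (\<forall>v \<in> verts G. in_degree G v = d \<and> out_degree G v = d)"

definition line_digraph :: "('a, 'b) pre_digraph \<Rightarrow> ('b, 'b \<times> 'b) pre_digraph" where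
  "line_digraph G =
     \<lparr> verts = arcs G,
       arcs = {(a, b). a \<in> arcs G \<and> b \<in> arcs G \<and> head G a = tail G b},
       tail = fst,
       head = snd \<rparr>"

definition out_nbrs_in :: "('a, 'b) pre_digraph \<Rightarrow> 'a \<Rightarrow> 'a set \<Rightarrow> nat" where
  "out_nbrs_in G u D = card {e \<in> out_arcs G u. head G e \<in> D}"

definition equitable_partition :: "('a, 'b) pre_digraph \<Rightarrow> 'a set set \<Rightarrow> bool" where
  "equitable_partition G P \<longleftrightarrow>
     partition_on (verts G) P \<and>
     (\<forall>C \<in> P. \<forall>D \<in> P. \<exists>b. \<forall>u \<in> C. out_nbrs_in G u D = b)"

text \<open>
  The common value \<open>b\<^sub>i\<^sub>j\<close>. It is well defined for cells of an equitable partition,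
  because these are nonempty.
\<close>

definition cell_mult :: "('a, 'b) pre_digraph \<Rightarrow> 'a set \<Rightarrow> 'a set \<Rightarrow> nat" where
  "cell_mult G C D = (THE b. \<forall>u \<in> C. out_nbrs_in G u D = b)"

text \<open>
  The arc \<open>(C, D, k)\<close> is the \<open>k\<close>-th of the \<^term>\<open>cell_mult G C D\<close> parallel arcs from \<open>C\<close> to \<open>D\<close>,
  so that the adjacency matrix of the quotient is \<open>(b\<^sub>i\<^sub>j)\<close>.
\<close>

definition quotient_digraph ::
    "('a, 'b) pre_digraph \<Rightarrow> 'a set set \<Rightarrow> ('a set, 'a set \<times> 'a set \<times> nat) pre_digraph" where
  "quotient_digraph G P =
     \<lparr> verts = P,
       arcs = {(C, D, k). C \<in> P \<and> D \<in> P \<and> k < cell_mult G C D},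
       tail = (\<lambda>(C, D, k). C),
       head = (\<lambda>(C, D, k). D) \<rparr>"

definition terminal_partition :: "('a, 'b) pre_digraph \<Rightarrow> 'b set set" where
  "terminal_partition G =
     arcs G // {(a, b). a \<in> arcs G \<and> b \<in> arcs G \<and> head G a = head G b}"

end

theory Submission
  imports Defs
begin

text \<open>
  When every vertex has an incoming arc, the classes of arcs with a common terminal vertex are
  the sets of arcs entering a vertex \<open>v\<close>, and thus correspond to the vertices. An arc entering
  \<open>u\<close> has as out-neighbours in the line digraph exactly the arcs leaving \<open>u\<close>, so it has as many
  out-neighbours in the class of \<open>v\<close> as there are arcs from \<open>u\<close> to \<open>v\<close>.
\<close>

lemma cell_mult_eqI:
  assumes "C \<noteq> {}" and "\<And>u. u \<in> C \<Longrightarrow> out_nbrs_in G u D = b"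
  shows "cell_mult G C D = b"
  unfolding cell_mult_def using assms by (intro the_equality) auto

lemma wf_quotient_digraph: "wf_digraph (quotient_digraph G P)"
  by unfold_locales (auto simp: quotient_digraph_def)

text \<open>Arcs of the line digraph are pairs, so \<open>Pair a\<close> is a bijection between the
  two counted sets. The count depends on \<open>a\<close> only through its head, which gives
  equitability.\<close>

lemma out_nbrs_in_line_digraph:
  assumes "a \<in> arcs G"
  shows "out_nbrs_in (line_digraph G) a (in_arcs G v) = card (out_arcs G (head G a) \<inter> in_arcs G v)"
proof -
  have "{e \<in> out_arcs (line_digraph G) a. head (line_digraph G) e \<in> in_arcs G v}
      = Pair a ` (out_arcs G (head G a) \<inter> in_arcs G v)"
    using assms by (auto simp: line_digraph_def out_arcs_def)
  then show ?thesis
    by (simp add: out_nbrs_in_def card_image inj_on_def)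
qed

text \<open>What \<open>G\<close> and its quotient have in common, so that one argument serves both.
  A vertex without incoming arcs would have no class of arcs to represent it.\<close>

locale sourceless_digraph = fin_digraph +
  assumes in_arcs_nonempty: "v \<in> verts G \<Longrightarrow> in_arcs G v \<noteq> {}"
begin

lemma terminal_partition_eq: "terminal_partition G = in_arcs G ` verts G"
proof -
  have "terminal_partition G = (\<lambda>a. in_arcs G (head G a)) ` arcs G"
    by (auto simp: terminal_partition_def quotient_def in_arcs_def image_iff eq_commute)
  also have "\<dots> = in_arcs G ` (head G ` arcs G)"
    by (simp add: image_image)
  also have "head G ` arcs G = verts G"
    using in_arcs_nonempty by (fastforce simp: in_arcs_def)
  finally show ?thesis .
qed

text \<open>An arc in the common value has only one head.\<close>

lemma inj_on_in_arcs: "inj_on (in_arcs G) (verts G)"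
  using in_arcs_nonempty by (fastforce simp: inj_on_def in_arcs_def)

lemma equitable_terminal_partition:
  "equitable_partition (line_digraph G) (terminal_partition G)"
  unfolding equitable_partition_def
proof (intro conjI ballI)
  have "equiv (arcs G) {(a, b). a \<in> arcs G \<and> b \<in> arcs G \<and> head G a = head G b}"
    by (auto simp: equiv_def refl_on_def sym_def trans_def)
  then show "partition_on (verts (line_digraph G)) (terminal_partition G)"
    by (simp add: terminal_partition_def line_digraph_def partition_on_quotient)
next
  fix C D assume "C \<in> terminal_partition G" "D \<in> terminal_partition G"
  then obtain u v where "C = in_arcs G u" "D = in_arcs G v"
    by (auto simp: terminal_partition_eq)
  then show "\<exists>b. \<forall>a\<in>C. out_nbrs_in (line_digraph G) a D = b"
    by (auto simp: out_nbrs_in_line_digraph)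
qed

text \<open>Since \<open>in_arcs G u\<close> is nonempty, the description in
  \<open>cell_mult\<close> has a unique solution.\<close>

lemma cell_mult_line_digraph:
  assumes "u \<in> verts G"
  shows "cell_mult (line_digraph G) (in_arcs G u) (in_arcs G v) = card (out_arcs G u \<inter> in_arcs G v)"
  using in_arcs_nonempty[OF assms]
  by (intro cell_mult_eqI) (auto simp: out_nbrs_in_line_digraph)

lemma quotient_line_digraph_iso:
  "digraph_iso (quotient_digraph (line_digraph G) (terminal_partition G)) G"
proof -
  let ?Q = "quotient_digraph (line_digraph G) (terminal_partition G)"
  let ?A = "\<lambda>u v. out_arcs G u \<inter> in_arcs G v"
  define t where "t = the_inv_into (verts G) (in_arcs G)"
  have t [simp]: "t (in_arcs G v) = v" if "v \<in> verts G" for v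
    using that by (simp add: t_def the_inv_into_f_f inj_on_in_arcs)
  \<comment> \<open>The quotient labels parallel arcs by numbers, so an arbitrary enumeration of the
    arcs of \<open>G\<close> from \<open>u\<close> to \<open>v\<close> matches them up.\<close>
  have "\<forall>u v. \<exists>h. bij_betw h {..<card (?A u v)} (?A u v)"
    using ex_bij_betw_nat_finite[of "?A _ _"] finite_in_arcs by (simp add: atLeast0LessThan)
  then obtain \<beta> where \<beta>: "bij_betw (\<beta> u v) {..<card (?A u v)} (?A u v)" for u v
    by metis
  \<comment> \<open>\<open>app_iso\<close> takes the tail and head maps of the image graph from
    \<open>iso_tail\<close> and \<open>iso_head\<close>. Choosing those of \<open>G\<close> makes
    the image literally equal to \<open>G\<close>.\<close>
  define f where "f = \<lparr>iso_verts = t, iso_arcs = (\<lambda>(C, D, k). \<beta> (t C) (t D) k),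
    iso_head = head G, iso_tail = tail G\<rparr>"
  have verts_Q: "verts ?Q = in_arcs G ` verts G"
    by (simp add: quotient_digraph_def terminal_partition_eq)
  have arcs_QI: "(in_arcs G u, in_arcs G v, k) \<in> arcs ?Q"
    if "u \<in> verts G" "v \<in> verts G" "k < card (?A u v)" for u v k
    using that by (simp add: quotient_digraph_def terminal_partition_eq cell_mult_line_digraph)
  have arcs_QE: "\<exists>u\<in>verts G. \<exists>v\<in>verts G. \<exists>k<card (?A u v). x = (in_arcs G u, in_arcs G v, k)"
    if "x \<in> arcs ?Q" for x
  proof -
    obtain u v k where x: "x = (in_arcs G u, in_arcs G v, k)" and uv: "u \<in> verts G" "v \<in> verts G"
      and "k < cell_mult (line_digraph G) (in_arcs G u) (in_arcs G v)"
      using \<open>x \<in> arcs ?Q\<close> by (auto simp: quotient_digraph_def terminal_partition_eq)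
    then have "k < card (?A u v)"
      by (simp add: cell_mult_line_digraph)
    with x uv show ?thesis
      by blast
  qed
  have ends_\<beta>: "\<beta> u v k \<in> arcs G" "tail G (\<beta> u v k) = u" "head G (\<beta> u v k) = v"
    if "k < card (?A u v)" for u v k
    using bij_betwE[OF \<beta>, of u v] that by auto
  have "inj_on (iso_arcs f) (arcs ?Q)"
  proof (rule inj_onI)
    fix x y assume "x \<in> arcs ?Q" "y \<in> arcs ?Q" and eq: "iso_arcs f x = iso_arcs f y"
    then obtain u v k u' v' k'
      where x: "x = (in_arcs G u, in_arcs G v, k)" "u \<in> verts G" "v \<in> verts G"
          "k < card (?A u v)"
        and y: "y = (in_arcs G u', in_arcs G v', k')" "u' \<in> verts G" "v' \<in> verts G"
          "k' < card (?A u' v')"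
      by (meson arcs_QE)
    \<comment> \<open>The ends of this common arc determine \<open>u\<close> and \<open>v\<close>.
      Injectivity of the enumeration \<open>\<beta> u v\<close> then determines
      \<open>k\<close>.\<close>
    have \<beta>_eq: "\<beta> u v k = \<beta> u' v' k'"
      using eq x y by (simp add: f_def)
    then have "u = u'" "v = v'"
      using ends_\<beta> x(4) y(4) by metis+
    then have "k = k'"
      using \<beta>_eq x(4) y(4) inj_onD[OF bij_betw_imp_inj_on[OF \<beta>]] by auto
    then show "x = y"
      using x y \<open>u = u'\<close> \<open>v = v'\<close> by simp
  qed
  moreover have "inj_on (iso_verts f) (verts ?Q)"
    by (auto simp: verts_Q f_def inj_on_def)
  moreover have "iso_verts f (tail ?Q x) = iso_tail f (iso_arcs f x) \<and>
      iso_verts f (head ?Q x) = iso_head f (iso_arcs f x)" if "x \<in> arcs ?Q" for x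
    using arcs_QE[OF that] by (auto simp: f_def quotient_digraph_def ends_\<beta>)
  ultimately have "pre_digraph.digraph_isomorphism ?Q f"
    by (simp add: pre_digraph.digraph_isomorphism_def wf_quotient_digraph)
  moreover have "iso_arcs f ` arcs ?Q = arcs G"
  proof (intro equalityI subsetI)
    fix e assume "e \<in> iso_arcs f ` arcs ?Q"
    then show "e \<in> arcs G"
      by (auto simp: f_def ends_\<beta> dest!: arcs_QE)
  next
    fix e assume e: "e \<in> arcs G"
    let ?u = "tail G e" and ?v = "head G e"
    \<comment> \<open>Every arc is listed by the enumeration belonging to its own ends.\<close>
    have "e \<in> \<beta> ?u ?v ` {..<card (?A ?u ?v)}"
      using e bij_betw_imp_surj_on[OF \<beta>, of ?u ?v] by simp
    then obtain k where k: "k < card (?A ?u ?v)" "e = \<beta> ?u ?v k"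
      by auto
    \<comment> \<open>The equation for \<open>e\<close> is used from right to left, because
      \<open>e\<close> also occurs in \<open>?u\<close> and \<open>?v\<close> and rewriting it would
      loop.\<close>
    have "iso_arcs f (in_arcs G ?u, in_arcs G ?v, k) = e"
      using e by (simp add: f_def flip: k(2))
    then show "e \<in> iso_arcs f ` arcs ?Q"
      using arcs_QI[OF _ _ k(1)] e by force
  qed
  then have "G = app_iso f ?Q"
    by (intro pre_digraph.equality) (auto simp: verts_Q f_def image_image)
  ultimately show ?thesis
    unfolding digraph_iso_def by blast
qed

end

text \<open>Every in-degree equals \<open>d\<close>, and \<open>d \<ge> 1\<close> excludes an empty
  set of incoming arcs.\<close>

lemma regular_digraph_sourceless:
  assumes "regular_digraph G d" and "d \<ge> 1"
  shows "sourceless_digraph G"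
proof -
  interpret fin_digraph G
    using assms(1) by (simp add: regular_digraph_def)
  show ?thesis
  proof
    fix v assume "v \<in> verts G"
    then have "card (in_arcs G v) = d"
      using assms(1) by (simp add: regular_digraph_def in_degree_def)
    then show "in_arcs G v \<noteq> {}"
      using assms(2) by auto
  qed
qed

theorem theorem3p1p12:
  fixes G :: "('a, 'b) pre_digraph" and \<pi> :: "'a set set" and d n :: nat
  assumes "d \<ge> 1"
    and "regular_digraph G d"
    and "card (verts G) = 2 * n"
    and "equitable_partition G \<pi>"
    and "card \<pi> = n"
    and "regular_digraph (quotient_digraph G \<pi>) d"
  shows "\<exists>\<tau> \<sigma>.
      \<tau> = terminal_partition G \<and>
      equitable_partition (line_digraph G) \<tau> \<and>
      \<sigma> = terminal_partition (quotient_digraph G \<pi>) \<and>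
      equitable_partition (line_digraph (quotient_digraph G \<pi>)) \<sigma> \<and>
      digraph_iso (quotient_digraph (line_digraph G) \<tau>) G \<and>
      digraph_iso (quotient_digraph (line_digraph (quotient_digraph G \<pi>)) \<sigma>)
        (quotient_digraph G \<pi>)"
proof -
  interpret G: sourceless_digraph G
    using assms by (intro regular_digraph_sourceless)
  \<comment> \<open>The quotient is itself \<open>d\<close>-regular by hypothesis, so the result for
    \<open>G\<close> applies to it verbatim.\<close>
  interpret Q: sourceless_digraph "quotient_digraph G \<pi>"
    using assms by (intro regular_digraph_sourceless)
  show ?thesis
    using G.equitable_terminal_partition G.quotient_line_digraph_iso
      Q.equitable_terminal_partition Q.quotient_line_digraph_iso
    by blast
qed

end
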